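(* Let $p_1,\dots,p_k$ be internal objects and write $\vec p=(p_1,\dots,p_k)$. Let $S_1,\dots,S_m$ be internal sets and $Q_1,\dots,Q_m\in\{\exists,\forall\}$. Let $\mathcal{U}$ be an ultrafilter on a set $Y$ and let $\phi(x_1,\dots,x_n,y_1,\dots,y_m,z_1,\dots,z_k)$ be a totally open formula. The following are equivalent: (1) for every $A\in\mathcal{U}$ there exist $\alpha_1,\dots,\alpha_n\in{}^{\ast}A$ such that $Q_1\beta_1\in S_1\dots Q_m\beta_m\in S_m\ {}^{\ast}\phi(\vec\alpha,\vec\beta,\vec p)$ holds; (2) there exist $\alpha_1,\dots,\alpha_n\in\mu(\mathcal{U})$ such that $Q_1\beta_1\in S_1\dots Q_m\beta_m\in S_m\ {}^{\ast}\phi(\vec\alpha,\vec\beta,\vec p)$ holds; where $\vec\alpha=(\alpha_1,\dots,\alpha_n)$, $\vec\beta=(\beta_1,\dots,\beta_m)$.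
   Context: Work in a single superstructure model $\langle\mathbb{V}(X),\mathbb{V}(X),\ast\rangle$ of nonstandard methods ($\ast$ a star map satisfying transfer) which is $|\mathcal{P}(Y)|^{+}$-saturated. Internal objects are elements of ${}^{\ast}B$ for some $B\in\mathbb{V}(X)$. Formulas are first-order with bounded quantifiers in the language of $\mathbb{V}(X)$; totally open means all variables free. $\mu(\mathcal{U})=\bigcap_{A\in\mathcal{U}}{}^{\ast}A$. *)

theory Defs
  imports Main
begin

unbundle cardinal_syntax

section \<open>Superstructures\<close>

text \<open>
  HOL has no type-level union of the iterated power sets of a set of atoms, so a superstructure
  is given by a type \<open>'a\<close> whose elements are exactly the elements of \<open>V(X)\<close>, a set \<open>X\<close> of atoms
  and a relation \<open>E x y\<close>, read ``\<open>x\<close> is an element of \<open>y\<close>''. The locale \<open>superstructure\<close> determines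
  these data up to isomorphism from the cardinality of \<open>X\<close>.
\<close>

definition elts :: "('a \<Rightarrow> 'a \<Rightarrow> bool) \<Rightarrow> 'a \<Rightarrow> 'a set" where
  "elts E y = {x. E x y}"

text \<open>\<open>V\<^sub>0(X) = X\<close> and \<open>V\<^sub>n\<^sub>+\<^sub>1(X) = V\<^sub>n(X) \<union> P(V\<^sub>n(X))\<close>.\<close>

primrec level :: "'a set \<Rightarrow> ('a \<Rightarrow> 'a \<Rightarrow> bool) \<Rightarrow> nat \<Rightarrow> 'a set" where
  "level X E 0 = X"
| "level X E (Suc n) = level X E n \<union> {v. v \<notin> X \<and> elts E v \<subseteq> level X E n}"

locale superstructure =
  fixes X :: "'a set" and E :: "'a \<Rightarrow> 'a \<Rightarrow> bool"
  assumes atoms_have_no_elements: "a \<in> X \<Longrightarrow> elts E a = {}"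
    and extensionality: "u \<notin> X \<Longrightarrow> v \<notin> X \<Longrightarrow> elts E u = elts E v \<Longrightarrow> u = v"
    and full_power_sets: "A \<subseteq> level X E n \<Longrightarrow> \<exists>v. v \<notin> X \<and> elts E v = A"
    and exhausted_by_levels: "\<exists>n. v \<in> level X E n"

text \<open>The object of the superstructure that is the set \<open>A\<close>; meaningful if \<open>A\<close> is contained in
  some level.\<close>

definition set_of :: "'a set \<Rightarrow> ('a \<Rightarrow> 'a \<Rightarrow> bool) \<Rightarrow> 'a set \<Rightarrow> 'a" where
  "set_of X E A = (THE v. v \<notin> X \<and> elts E v = A)"

text \<open>Kuratowski pairs.\<close>

definition pair :: "'a set \<Rightarrow> ('a \<Rightarrow> 'a \<Rightarrow> bool) \<Rightarrow> 'a \<Rightarrow> 'a \<Rightarrow> 'a" where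
  "pair X E x y = set_of X E {set_of X E {x}, set_of X E {x, y}}"

text \<open>The value of \<open>f\<close> at \<open>x\<close>, with the convention that it is the empty set where \<open>f\<close> is not
  single-valued at \<open>x\<close>.\<close>

definition app :: "'a set \<Rightarrow> ('a \<Rightarrow> 'a \<Rightarrow> bool) \<Rightarrow> 'a \<Rightarrow> 'a \<Rightarrow> 'a" where
  "app X E f x =
    (if \<exists>!y. E (pair X E x y) f then THE y. E (pair X E x y) f else set_of X E {})"


section \<open>The language of the superstructure\<close>

text \<open>
  The language has \<open>=\<close>, \<open>\<in>\<close>, a constant for every object of \<open>V(X)\<close>, pairs and function values.
  In particular \<open>R(t\<^sub>1,\<dots>,t\<^sub>r)\<close> for a relation \<open>R\<close> of \<open>V(X)\<close> is the atomic formula saying that the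
  tuple of the \<open>t\<^sub>i\<close> belongs to the constant \<open>R\<close>. All quantifiers are bounded:
  \<open>AllIn i t \<phi>\<close> is \<open>\<forall>v\<^sub>i \<in> t. \<phi>\<close>, where \<open>t\<close> is outside the scope of the quantifier.
\<close>

datatype 'a trm =
  Var nat
| Const 'a
| Pair "'a trm" "'a trm"
| App "'a trm" "'a trm"

datatype 'a fm =
  Eq "'a trm" "'a trm"
| Mem "'a trm" "'a trm"
| Neg "'a fm"
| Conj "'a fm" "'a fm"
| Disj "'a fm" "'a fm"
| Imp "'a fm" "'a fm"
| ExIn nat "'a trm" "'a fm"
| AllIn nat "'a trm" "'a fm"

primrec tvars :: "'a trm \<Rightarrow> nat set" where
  "tvars (Var i) = {i}"
| "tvars (Const c) = {}"
| "tvars (Pair s t) = tvars s \<union> tvars t"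
| "tvars (App s t) = tvars s \<union> tvars t"

primrec fvars :: "'a fm \<Rightarrow> nat set" where
  "fvars (Eq s t) = tvars s \<union> tvars t"
| "fvars (Mem s t) = tvars s \<union> tvars t"
| "fvars (Neg \<phi>) = fvars \<phi>"
| "fvars (Conj \<phi> \<psi>) = fvars \<phi> \<union> fvars \<psi>"
| "fvars (Disj \<phi> \<psi>) = fvars \<phi> \<union> fvars \<psi>"
| "fvars (Imp \<phi> \<psi>) = fvars \<phi> \<union> fvars \<psi>"
| "fvars (ExIn i t \<phi>) = tvars t \<union> (fvars \<phi> - {i})"
| "fvars (AllIn i t \<phi>) = tvars t \<union> (fvars \<phi> - {i})"

primrec bvars :: "'a fm \<Rightarrow> nat set" where
  "bvars (Eq s t) = {}"
| "bvars (Mem s t) = {}"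
| "bvars (Neg \<phi>) = bvars \<phi>"
| "bvars (Conj \<phi> \<psi>) = bvars \<phi> \<union> bvars \<psi>"
| "bvars (Disj \<phi> \<psi>) = bvars \<phi> \<union> bvars \<psi>"
| "bvars (Imp \<phi> \<psi>) = bvars \<phi> \<union> bvars \<psi>"
| "bvars (ExIn i t \<phi>) = insert i (bvars \<phi>)"
| "bvars (AllIn i t \<phi>) = insert i (bvars \<phi>)"

definition totally_open :: "'a fm \<Rightarrow> bool" where
  "totally_open \<phi> \<longleftrightarrow> bvars \<phi> = {}"

primrec tval :: "'a set \<Rightarrow> ('a \<Rightarrow> 'a \<Rightarrow> bool) \<Rightarrow> (nat \<Rightarrow> 'a) \<Rightarrow> 'a trm \<Rightarrow> 'a" where
  "tval X E e (Var i) = e i"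
| "tval X E e (Const c) = c"
| "tval X E e (Pair s t) = pair X E (tval X E e s) (tval X E e t)"
| "tval X E e (App s t) = app X E (tval X E e s) (tval X E e t)"

primrec sat :: "'a set \<Rightarrow> ('a \<Rightarrow> 'a \<Rightarrow> bool) \<Rightarrow> (nat \<Rightarrow> 'a) \<Rightarrow> 'a fm \<Rightarrow> bool" where
  "sat X E e (Eq s t) \<longleftrightarrow> tval X E e s = tval X E e t"
| "sat X E e (Mem s t) \<longleftrightarrow> E (tval X E e s) (tval X E e t)"
| "sat X E e (Neg \<phi>) \<longleftrightarrow> \<not> sat X E e \<phi>"
| "sat X E e (Conj \<phi> \<psi>) \<longleftrightarrow> sat X E e \<phi> \<and> sat X E e \<psi>"
| "sat X E e (Disj \<phi> \<psi>) \<longleftrightarrow> sat X E e \<phi> \<or> sat X E e \<psi>"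
| "sat X E e (Imp \<phi> \<psi>) \<longleftrightarrow> (sat X E e \<phi> \<longrightarrow> sat X E e \<psi>)"
| "sat X E e (ExIn i t \<phi>) \<longleftrightarrow> (\<exists>a \<in> elts E (tval X E e t). sat X E (e(i := a)) \<phi>)"
| "sat X E e (AllIn i t \<phi>) \<longleftrightarrow> (\<forall>a \<in> elts E (tval X E e t). sat X E (e(i := a)) \<phi>)"

text \<open>\<open>\<^sup>*\<phi>\<close>: every constant \<open>c\<close> occurring in \<open>\<phi>\<close> is replaced by \<open>\<^sup>*c\<close>.\<close>

abbreviation star_fm :: "('a \<Rightarrow> 'a) \<Rightarrow> 'a fm \<Rightarrow> 'a fm" where
  "star_fm star \<phi> \<equiv> map_fm star \<phi>"


section \<open>Nonstandard models on a single superstructure\<close>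

text \<open>A star map from \<open>V(X)\<close> to \<open>V(Z)\<close> sends the set \<open>X\<close> to the set \<open>Z\<close>; here \<open>Z = X\<close>.\<close>

locale nonstandard_model = superstructure X E
  for X :: "'a set" and E :: "'a \<Rightarrow> 'a \<Rightarrow> bool" +
  fixes star :: "'a \<Rightarrow> 'a"
  assumes star_atoms: "star (set_of X E X) = set_of X E X"
    and transfer: "sat X E e \<phi> \<longleftrightarrow> sat X E (star \<circ> e) (star_fm star \<phi>)"

definition internal :: "('a \<Rightarrow> 'a \<Rightarrow> bool) \<Rightarrow> ('a \<Rightarrow> 'a) \<Rightarrow> 'a \<Rightarrow> bool" where
  "internal E star x \<longleftrightarrow> (\<exists>B. E x (star B))"

definition internal_set :: "'a set \<Rightarrow> ('a \<Rightarrow> 'a \<Rightarrow> bool) \<Rightarrow> ('a \<Rightarrow> 'a) \<Rightarrow> 'a \<Rightarrow> bool" where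
  "internal_set X E star x \<longleftrightarrow> internal E star x \<and> x \<notin> X"

definition saturated ::
    "'a set \<Rightarrow> ('a \<Rightarrow> 'a \<Rightarrow> bool) \<Rightarrow> ('a \<Rightarrow> 'a) \<Rightarrow> 'k rel \<Rightarrow> bool" where
  "saturated X E star \<kappa> \<longleftrightarrow>
    (\<forall>F. (\<forall>I\<in>F. internal_set X E star I) \<and> |F| <o \<kappa> \<and>
         (\<forall>G. G \<subseteq> F \<and> finite G \<longrightarrow> (\<Inter>I\<in>G. elts E I) \<noteq> {}) \<longrightarrow>
         (\<Inter>I\<in>F. elts E I) \<noteq> {})"

definition ultrafilter_on :: "'b set \<Rightarrow> 'b set set \<Rightarrow> bool" where
  "ultrafilter_on Y F \<longleftrightarrow>
     F \<subseteq> Pow Y \<and> Y \<in> F \<and> {} \<notin> F \<and>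
     (\<forall>A\<in>F. \<forall>B\<in>F. A \<inter> B \<in> F) \<and>
     (\<forall>A\<in>F. \<forall>B. A \<subseteq> B \<and> B \<subseteq> Y \<longrightarrow> B \<in> F) \<and>
     (\<forall>A. A \<subseteq> Y \<longrightarrow> A \<in> F \<or> Y - A \<in> F)"

definition ultrafilter_obj :: "('a \<Rightarrow> 'a \<Rightarrow> bool) \<Rightarrow> 'a \<Rightarrow> 'a \<Rightarrow> bool" where
  "ultrafilter_obj E Y U \<longleftrightarrow> ultrafilter_on (elts E Y) (elts E ` elts E U)"

definition monad :: "('a \<Rightarrow> 'a \<Rightarrow> bool) \<Rightarrow> ('a \<Rightarrow> 'a) \<Rightarrow> 'a \<Rightarrow> 'a set" where
  "monad E star U = (\<Inter>A\<in>elts E U. elts E (star A))"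

datatype quantifier = Exists | Forall

text \<open>\<open>quantify E [(Q\<^sub>1, S\<^sub>1), \<dots>, (Q\<^sub>m, S\<^sub>m)] P\<close> is
  \<open>Q\<^sub>1 \<beta>\<^sub>1 \<in> S\<^sub>1 \<dots> Q\<^sub>m \<beta>\<^sub>m \<in> S\<^sub>m. P [\<beta>\<^sub>1, \<dots>, \<beta>\<^sub>m]\<close>.\<close>

fun quantify ::
    "('a \<Rightarrow> 'a \<Rightarrow> bool) \<Rightarrow> (quantifier \<times> 'a) list \<Rightarrow> ('a list \<Rightarrow> bool) \<Rightarrow> bool" where
  "quantify E [] P \<longleftrightarrow> P []"
| "quantify E ((Exists, S) # qs) P \<longleftrightarrow> (\<exists>b\<in>elts E S. quantify E qs (\<lambda>bs. P (b # bs)))"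
| "quantify E ((Forall, S) # qs) P \<longleftrightarrow> (\<forall>b\<in>elts E S. quantify E qs (\<lambda>bs. P (b # bs)))"

text \<open>The variable \<open>v\<^sub>i\<close> takes the \<open>i\<close>-th entry (from 0) of the list \<open>as\<close>; used only for formulas
  whose free variables are below its length.\<close>

definition sat_list :: "'a set \<Rightarrow> ('a \<Rightarrow> 'a \<Rightarrow> bool) \<Rightarrow> 'a list \<Rightarrow> 'a fm \<Rightarrow> bool" where
  "sat_list X E as \<phi> \<longleftrightarrow> sat X E (\<lambda>i. as ! i) \<phi>"

end

theory Submission
  imports Defs
begin

text \<open>
  For \<open>A \<in> U\<close> the set of all \<open>a \<in> \<^sup>*A\<close> that extend to a solution with the remaining \<open>\<alpha>\<^sub>i\<close> in \<open>\<^sup>*A\<close>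
  is internal, by the internal definition principle applied with the \<open>S\<^sub>i\<close> and \<open>p\<^sub>i\<close> as parameters.
  These sets are nonempty and monotone in \<open>A\<close>, so they have the finite intersection property, and
  there are at most \<open>|P(Y)|\<close> of them. Saturation gives a common element \<open>\<alpha>\<^sub>1 \<in> \<mu>(U)\<close>, which becomes
  a new internal parameter; thus the \<open>\<alpha>\<^sub>i\<close> are found one at a time, without coding tuples.
\<close>

section \<open>Formulas and assignments\<close>

lemma finite_tvars: "finite (tvars t)"
  by (induction t) auto

lemma finite_fvars: "finite (fvars \<phi>)"
  by (induction \<phi>) (auto simp: finite_tvars)

lemma tvars_map_trm [simp]: "tvars (map_trm f t) = tvars t"
  by (induction t) auto

lemma fvars_map_fm [simp]: "fvars (map_fm f \<phi>) = fvars \<phi>"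
  by (induction \<phi>) auto

lemma tval_cong: "(\<And>i. i \<in> tvars t \<Longrightarrow> e i = e' i) \<Longrightarrow> tval X E e t = tval X E e' t"
  by (induction t) auto

lemma sat_cong: "(\<And>i. i \<in> fvars \<phi> \<Longrightarrow> e i = e' i) \<Longrightarrow> sat X E e \<phi> \<longleftrightarrow> sat X E e' \<phi>"
proof (induction \<phi> arbitrary: e e')
  case (Eq s t)
  then show ?case using tval_cong[of s e e'] tval_cong[of t e e'] by simp
next
  case (Mem s t)
  then show ?case using tval_cong[of s e e'] tval_cong[of t e e'] by simp
next
  case (Neg \<phi>)
  have "sat X E e \<phi> \<longleftrightarrow> sat X E e' \<phi>"
    using Neg.prems by (intro Neg.IH) simp
  then show ?case by simp
next
  case (Conj \<phi> \<psi>)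
  have "sat X E e \<phi> \<longleftrightarrow> sat X E e' \<phi>" "sat X E e \<psi> \<longleftrightarrow> sat X E e' \<psi>"
    using Conj.prems by (intro Conj.IH; simp)+
  then show ?case by simp
next
  case (Disj \<phi> \<psi>)
  have "sat X E e \<phi> \<longleftrightarrow> sat X E e' \<phi>" "sat X E e \<psi> \<longleftrightarrow> sat X E e' \<psi>"
    using Disj.prems by (intro Disj.IH; simp)+
  then show ?case by simp
next
  case (Imp \<phi> \<psi>)
  have "sat X E e \<phi> \<longleftrightarrow> sat X E e' \<phi>" "sat X E e \<psi> \<longleftrightarrow> sat X E e' \<psi>"
    using Imp.prems by (intro Imp.IH; simp)+
  then show ?case by simp
next
  case (ExIn i t \<phi>)
  have "sat X E (e(i := a)) \<phi> \<longleftrightarrow> sat X E (e'(i := a)) \<phi>" for a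
    using ExIn.prems by (intro ExIn.IH) auto
  then show ?case using ExIn.prems tval_cong[of t e e'] by simp
next
  case (AllIn i t \<phi>)
  have "sat X E (e(i := a)) \<phi> \<longleftrightarrow> sat X E (e'(i := a)) \<phi>" for a
    using AllIn.prems by (intro AllIn.IH) auto
  then show ?case using AllIn.prems tval_cong[of t e e'] by simp
qed

text \<open>Successive updates mirror the single update that each bounded quantifier makes in
  \<open>sat\<close>, so inductions along a quantifier prefix match step by step.\<close>

primrec assign :: "(nat \<Rightarrow> 'a) \<Rightarrow> nat \<Rightarrow> 'a list \<Rightarrow> nat \<Rightarrow> 'a" where
  "assign e j [] = e"
| "assign e j (x # xs) = assign (e(j := x)) (Suc j) xs"

lemma assign_apply:
  "assign e j xs i = (if j \<le> i \<and> i < j + length xs then xs ! (i - j) else e i)"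
proof (induction xs arbitrary: e j)
  case (Cons x xs)
  show ?case
    by (auto simp: Cons nth_Cons' Suc_le_eq)
qed auto

text \<open>The syntactic counterpart of \<open>quantify\<close>. The bounds are terms because
  constants of a starred formula all have the form \<open>star c\<close>; other internal sets must
  enter as values of variables.\<close>

fun quantified :: "nat \<Rightarrow> (quantifier \<times> 'a trm) list \<Rightarrow> 'a fm \<Rightarrow> 'a fm" where
  "quantified j [] \<phi> = \<phi>"
| "quantified j ((Exists, t) # qs) \<phi> = ExIn j t (quantified (Suc j) qs \<phi>)"
| "quantified j ((Forall, t) # qs) \<phi> = AllIn j t (quantified (Suc j) qs \<phi>)"

lemma map_fm_quantified:
  "map_fm f (quantified j qs \<phi>) = quantified j (map (map_prod id (map_trm f)) qs) (map_fm f \<phi>)"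
  by (induction j qs \<phi> rule: quantified.induct) auto

lemma quantify_cong:
  "(\<And>bs. length bs = length qs \<Longrightarrow> P bs \<longleftrightarrow> P' bs) \<Longrightarrow> quantify E qs P \<longleftrightarrow> quantify E qs P'"
proof (induction E qs P arbitrary: P' rule: quantify.induct)
  case (2 E S qs P)
  have "quantify E qs (\<lambda>bs. P (b # bs)) \<longleftrightarrow> quantify E qs (\<lambda>bs. P' (b # bs))" if "b \<in> elts E S" for b
    using 2 that by auto
  then show ?case by simp
next
  case (3 E S qs P)
  have "quantify E qs (\<lambda>bs. P (b # bs)) \<longleftrightarrow> quantify E qs (\<lambda>bs. P' (b # bs))" if "b \<in> elts E S" for b
    using 3 that by auto
  then show ?case by simp
qed simp

text \<open>No bound mentions a variable of the block, so the outer quantifiers do not change the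
  values of the inner bounds, and all bounds can be evaluated in \<open>e\<close>
  beforehand.\<close>

lemma sat_quantified:
  assumes "\<And>q t i. (q, t) \<in> set qs \<Longrightarrow> i \<in> tvars t \<Longrightarrow> i < j \<or> j + length qs \<le> i"
  shows "sat X E e (quantified j qs \<phi>) \<longleftrightarrow>
    quantify E (map (map_prod id (tval X E e)) qs) (\<lambda>bs. sat X E (assign e j bs) \<phi>)"
  using assms
proof (induction qs arbitrary: e j)
  case (Cons qt qs)
  obtain q t where qt: "qt = (q, t)" by force
  have vals: "map (map_prod id (tval X E (e(j := b)))) qs = map (map_prod id (tval X E e)) qs" for b
    using Cons.prems by (fastforce intro!: tval_cong)
  have "i < Suc j \<or> Suc j + length qs \<le> i" if "(q', t') \<in> set qs" "i \<in> tvars t'" for q' t' i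
    using Cons.prems[of q' t' i] that by auto
  from Cons.IH[OF this] have
    "sat X E (e(j := b)) (quantified (Suc j) qs \<phi>) \<longleftrightarrow> quantify E
      (map (map_prod id (tval X E e)) qs) (\<lambda>bs. sat X E (assign (e(j := b)) (Suc j) bs) \<phi>)" for b
    by (simp only: vals)
  then show ?case by (cases q) (simp_all add: qt id_def)
qed simp

lemma quantify_replicate_Exists:
  "quantify E (replicate n (Exists, S)) P \<longleftrightarrow> (\<exists>\<alpha>. length \<alpha> = n \<and> set \<alpha> \<subseteq> elts E S \<and> P \<alpha>)"
proof (induction n arbitrary: P)
  case (Suc n)
  have "(\<exists>\<alpha>. length \<alpha> = Suc n \<and> set \<alpha> \<subseteq> elts E S \<and> P \<alpha>) \<longleftrightarrow>
      (\<exists>b \<alpha>. length (b # \<alpha>) = Suc n \<and> set (b # \<alpha>) \<subseteq> elts E S \<and> P (b # \<alpha>))"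
    by (metis length_Suc_conv)
  then show ?case by (auto simp: Suc)
qed simp

section \<open>Superstructures\<close>

context superstructure
begin

lemma elts_subset_level: "\<exists>n. elts E v \<subseteq> level X E n"
proof -
  have "v \<in> level X E n \<Longrightarrow> \<exists>m. elts E v \<subseteq> level X E m" for n
    by (induction n) (auto simp: atoms_have_no_elements)
  then show ?thesis using exhausted_by_levels by blast
qed

lemma ex_power_set: "\<exists>P. elts E P = {v. v \<notin> X \<and> elts E v \<subseteq> elts E A}"
proof -
  obtain n where "elts E A \<subseteq> level X E n" using elts_subset_level by blast
  then have "{v. v \<notin> X \<and> elts E v \<subseteq> elts E A} \<subseteq> level X E (Suc n)" by auto
  from full_power_sets[OF this] show ?thesis by blast
qed

lemma ex_singleton: "\<exists>B. elts E B = {c}"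
proof -
  obtain n where "{c} \<subseteq> level X E n" using exhausted_by_levels by blast
  from full_power_sets[OF this] show ?thesis by blast
qed

lemma elts_set_of:
  assumes "A \<subseteq> level X E n"
  shows "elts E (set_of X E A) = A"
proof -
  have "\<exists>!v. v \<notin> X \<and> elts E v = A"
    using full_power_sets[OF assms] extensionality by metis
  from theI'[OF this] show ?thesis by (simp add: set_of_def)
qed

lemma elts_set_of_atoms: "elts E (set_of X E X) = X"
  by (rule elts_set_of[of _ 0]) simp

end

section \<open>Transfer and internal sets\<close>

context nonstandard_model
begin

text \<open>The axiom \<open>transfer\<close> covers only assignments \<open>star \<circ> e\<close>.
  Binding each free variable by a constant \<open>C i\<close> gives a sentence, and its transfer can
  be instantiated with arbitrary elements of the sets \<open>star (C i)\<close>.\<close>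

lemma transfer_bounded:
  assumes true: "\<And>e. (\<And>i. i \<in> fvars \<chi> \<Longrightarrow> E (e i) (C i)) \<Longrightarrow> sat X E e \<chi>"
    and e: "\<And>i. i \<in> fvars \<chi> \<Longrightarrow> E (e i) (star (C i))"
  shows "sat X E e (star_fm star \<chi>)"
proof -
  define closure where
    "closure vs = foldr (\<lambda>i \<psi>. AllIn i (Const (C i)) \<psi>) vs \<chi>" for vs
  have closure_iff: "sat X E e0 (closure vs) \<longleftrightarrow>
      (\<forall>e. (\<forall>i\<in>set vs. E (e i) (C i)) \<and> (\<forall>i. i \<notin> set vs \<longrightarrow> e i = e0 i) \<longrightarrow> sat X E e \<chi>)"
    if "distinct vs" for vs e0
    using that
  proof (induction vs arbitrary: e0)
    case Nil
    have "(\<forall>i. e i = e0 i) \<longleftrightarrow> e = e0" for e :: "nat \<Rightarrow> 'a" by auto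
    then show ?case by (simp add: closure_def)
  next
    case (Cons j vs)
    have "sat X E e0 (closure (j # vs)) \<longleftrightarrow>
        (\<forall>a. E a (C j) \<longrightarrow> sat X E (e0(j := a)) (closure vs))"
      by (simp add: closure_def elts_def)
    also have "\<dots> \<longleftrightarrow> (\<forall>a. E a (C j) \<longrightarrow> (\<forall>e. (\<forall>i\<in>set vs. E (e i) (C i)) \<and>
        (\<forall>i. i \<notin> set vs \<longrightarrow> e i = (e0(j := a)) i) \<longrightarrow> sat X E e \<chi>))"
      using Cons by simp
    also have "\<dots> \<longleftrightarrow> (\<forall>e. (\<forall>i\<in>set (j # vs). E (e i) (C i)) \<and>
        (\<forall>i. i \<notin> set (j # vs) \<longrightarrow> e i = e0 i) \<longrightarrow> sat X E e \<chi>)"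
      using Cons.prems by (auto split: if_splits)
    finally show ?case .
  qed
  \<comment> \<open>After transfer only instantiation is needed: each quantifier, from the outside
    in, receives the value of \<open>e'\<close>.\<close>
  have star_closureD: "sat X E e' (star_fm star \<chi>)"
    if "sat X E e0 (star_fm star (closure vs))" "\<forall>i\<in>set vs. E (e' i) (star (C i))"
      "\<forall>i. i \<notin> set vs \<longrightarrow> e' i = e0 i" for vs e' e0
    using that
  proof (induction vs arbitrary: e0)
    case Nil
    then have "e' = e0" by auto
    then show ?case using Nil by (simp add: closure_def)
  next
    case (Cons j vs)
    have "sat X E (e0(j := e' j)) (star_fm star (closure vs))"
      using Cons.prems by (simp add: closure_def elts_def)
    then show ?case by (rule Cons.IH) (use Cons.prems in auto)
  qed
  obtain vs where vs: "set vs = fvars \<chi>" "distinct vs"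
    using finite_distinct_list[OF finite_fvars] by blast
  have "sat X E undefined (closure vs)"
    unfolding closure_iff[OF vs(2)] using true vs(1) by blast
  then have "sat X E (star \<circ> undefined) (star_fm star (closure vs))"
    using transfer by blast
  \<comment> \<open>The case distinction provides the agreement with the starting assignment off the
    free variables; \<open>sat_cong\<close> then removes it.\<close>
  then have "sat X E (\<lambda>i. if i \<in> fvars \<chi> then e i else (star \<circ> undefined) i) (star_fm star \<chi>)"
    by (rule star_closureD) (use vs e in auto)
  then show ?thesis
    by (subst sat_cong) auto
qed

lemma elts_star_mono:
  assumes "elts E A \<subseteq> elts E B"
  shows "elts E (star A) \<subseteq> elts E (star B)"
proof -
  have "sat X E e (AllIn 0 (Const A) (Mem (Var 0) (Const B)))" for e
    using assms by (auto simp: elts_def)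
  from iffD1[OF transfer this] show ?thesis by (auto simp: elts_def)
qed

lemma internal_star: "internal E star (star c)"
proof -
  obtain B where "elts E B = {c}" using ex_singleton by blast
  then have "sat X E e (Mem (Const c) (Const B))" for e by (auto simp: elts_def)
  from iffD1[OF transfer this] show ?thesis by (auto simp: internal_def)
qed

text \<open>Transferred separation: since power sets are full, every formula cuts a member of the
  power set \<open>P\<close> out of \<open>A\<close>. The transferred statement yields a member of
  \<open>star P\<close>, which is internal, and \<open>transfer_bounded\<close> admits internal
  parameters.\<close>

lemma internal_definition:
  assumes internal: "\<And>j. internal E star (e j)"
  shows "\<exists>I. internal_set X E star I \<and>
    elts E I = {a \<in> elts E (star A). sat X E (e(i := a)) (star_fm star \<phi>)}"
proof -
  obtain P where P: "elts E P = {v. v \<notin> X \<and> elts E v \<subseteq> elts E A}"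
    using ex_power_set by blast
  obtain C where C: "\<And>j. E (e j) (star (C j))"
    using internal unfolding internal_def by metis
  obtain w where w: "w \<notin> insert i (fvars \<phi>)"
    using ex_new_if_finite[OF infinite_UNIV_nat, of "insert i (fvars \<phi>)"] finite_fvars by blast
  define \<chi> where "\<chi> = ExIn w (Const P) (AllIn i (Const A)
    (Conj (Imp (Mem (Var i) (Var w)) \<phi>) (Imp \<phi> (Mem (Var i) (Var w)))))"
  have fresh: "sat X E (f(w := I, i := a)) (map_fm g \<phi>) \<longleftrightarrow> sat X E (f(i := a)) (map_fm g \<phi>)"
    for f g I a
    by (rule sat_cong) (use w in auto)
  have "sat X E f \<chi>" for f
  proof -
    obtain n where "elts E A \<subseteq> level X E n" using elts_subset_level by blast
    then have "{a \<in> elts E A. sat X E (f(i := a)) \<phi>} \<subseteq> level X E n" by auto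
    from full_power_sets[OF this] obtain I where
      "I \<notin> X" "elts E I = {a \<in> elts E A. sat X E (f(i := a)) \<phi>}" by blast
    moreover from this have "I \<in> elts E P" by (simp add: P)
    ultimately show ?thesis
      using w fresh[of f _ _ id] unfolding \<chi>_def
      by (auto simp: fm.map_id0 elts_def intro!: bexI[of _ I])
  qed
  then have "sat X E e (star_fm star \<chi>)"
    by (rule transfer_bounded) (rule C)
  then obtain I where I: "I \<in> elts E (star P)"
    and I_iff: "\<And>a. a \<in> elts E (star A) \<Longrightarrow>
      E a I \<longleftrightarrow> sat X E (e(i := a)) (star_fm star \<phi>)"
    using w fresh[of e] unfolding \<chi>_def by simp blast
  \<comment> \<open>\<open>I_iff\<close> says nothing about elements outside \<open>star A\<close>.
    Transferring this sentence confines \<open>I\<close> to \<open>star A\<close> and, by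
    \<open>star_atoms\<close>, shows that \<open>I\<close> is not an atom.\<close>
  have "sat X E f (AllIn 0 (Const P) (Conj (Neg (Mem (Var 0) (Const (set_of X E X))))
      (AllIn 1 (Var 0) (Mem (Var 1) (Const A)))))" for f
    using P elts_set_of_atoms by (auto simp: elts_def)
  from iffD1[OF transfer this] have "I \<notin> X" "elts E I \<subseteq> elts E (star A)"
    using I elts_set_of_atoms star_atoms by (auto simp: elts_def)
  moreover have "internal E star I" using I by (auto simp: internal_def elts_def)
  moreover have "elts E I = {a \<in> elts E (star A). sat X E (e(i := a)) (star_fm star \<phi>)}"
    using calculation(2) I_iff by (auto simp: elts_def)
  ultimately show ?thesis unfolding internal_set_def by blast
qed

section \<open>Solutions in the monad of an ultrafilter\<close>

lemma ultrafilter_obj_nonempty: "ultrafilter_obj E Y U \<Longrightarrow> elts E U \<noteq> {}"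
  by (auto simp: ultrafilter_obj_def ultrafilter_on_def)

lemma ultrafilter_obj_finite_inter:
  assumes U: "ultrafilter_obj E Y U" and "finite H" "H \<subseteq> elts E U"
  shows "\<exists>C\<in>elts E U. \<forall>A\<in>H. elts E C \<subseteq> elts E A"
  using assms(2,3)
proof (induction H)
  case empty
  then show ?case using ultrafilter_obj_nonempty[OF U] by auto
next
  case (insert A H)
  then obtain C where C: "C \<in> elts E U" "\<forall>A\<in>H. elts E C \<subseteq> elts E A" by auto
  have "\<forall>B\<in>elts E ` elts E U. \<forall>B'\<in>elts E ` elts E U. B \<inter> B' \<in> elts E ` elts E U"
    using U unfolding ultrafilter_obj_def ultrafilter_on_def by (elim conjE)
  then have "elts E C \<inter> elts E A \<in> elts E ` elts E U"
    using C(1) insert.prems by simp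
  then obtain D where "D \<in> elts E U" "elts E D = elts E C \<inter> elts E A" by auto
  with C(2) show ?case by (metis insert_iff inf.boundedE order_refl subset_trans)
qed

text \<open>Members of an ultrafilter are nonempty, hence not atoms, so extensionality makes
  \<open>elts E\<close> injective on them.\<close>

lemma card_ultrafilter_obj:
  assumes "ultrafilter_obj E Y U"
  shows "|elts E U| \<le>o |Pow (elts E Y)|"
proof (rule card_of_ordLeqI)
  have "A \<notin> X" if "A \<in> elts E U" for A
    using assms that atoms_have_no_elements[of A]
    unfolding ultrafilter_obj_def ultrafilter_on_def by force
  then show "inj_on (elts E) (elts E U)"
    by (auto intro!: inj_onI extensionality)
  have "elts E ` elts E U \<subseteq> Pow (elts E Y)"
    using assms unfolding ultrafilter_obj_def ultrafilter_on_def by (elim conjE)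
  then show "elts E A \<in> Pow (elts E Y)" if "A \<in> elts E U" for A
    using that by blast
qed

text \<open>The induction on \<open>n\<close> varies \<open>e\<close> and \<open>i\<close>, because
  each point found becomes the value of variable \<open>i\<close> and thereby a parameter for the
  remaining ones.\<close>

lemma solution_in_monad:
  assumes sat: "saturated X E star (cardSuc |Pow (elts E Y)| )"
    and U: "ultrafilter_obj E Y U"
    and "\<And>j. internal E star (e j)"
    and "\<And>A. A \<in> elts E U \<Longrightarrow>
      sat X E e (star_fm star (quantified i (replicate n (Exists, Const A)) \<psi>))"
  shows "\<exists>\<alpha>. length \<alpha> = n \<and> set \<alpha> \<subseteq> monad E star U \<and>
    sat X E (assign e i \<alpha>) (star_fm star \<psi>)"
  using assms(3,4)
proof (induction n arbitrary: e i)
  case 0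
  then show ?case using ultrafilter_obj_nonempty[OF U] by auto
next
  case (Suc n)
  define \<psi>' where "\<psi>' A = quantified (Suc i) (replicate n (Exists, Const A)) \<psi>" for A
  define solutions where
    "solutions A = {a \<in> elts E (star A). sat X E (e(i := a)) (star_fm star (\<psi>' A))}" for A
  \<comment> \<open>In this form monotonicity in \<open>A\<close> is visible: enlarging
    \<open>star A\<close> keeps every witness list.\<close>
  have \<psi>'_iff: "sat X E f (star_fm star (\<psi>' A)) \<longleftrightarrow> (\<exists>\<alpha>. length \<alpha> = n \<and>
      set \<alpha> \<subseteq> elts E (star A) \<and> sat X E (assign f (Suc i) \<alpha>) (star_fm star \<psi>))" for f A
    unfolding \<psi>'_def map_fm_quantified
    by (subst sat_quantified) (auto simp: quantify_replicate_Exists)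
  have "\<exists>I. internal_set X E star I \<and> elts E I = solutions A" for A
    unfolding solutions_def by (rule internal_definition[OF Suc.prems(1)])
  then obtain I where I: "\<And>A. internal_set X E star (I A)" "\<And>A. elts E (I A) = solutions A"
    by metis
  have mono: "solutions A \<subseteq> solutions B" if "elts E A \<subseteq> elts E B" for A B
    using elts_star_mono[OF that] unfolding solutions_def \<psi>'_iff by blast
  have nonempty: "solutions A \<noteq> {}" if "A \<in> elts E U" for A
    using Suc.prems(2)[OF that] by (auto simp: solutions_def \<psi>'_def)
  have fip: "(\<Inter>J\<in>G. elts E J) \<noteq> {}" if G: "finite G" "G \<subseteq> I ` elts E U" for G
  proof -
    obtain H where H: "H \<subseteq> elts E U" "finite H" "G = I ` H"
      using finite_subset_image[OF G] by blast
    \<comment> \<open>Every solution for a lower bound \<open>C\<close> in \<open>U\<close> is a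
      solution for each chosen set.\<close>
    then obtain C where C: "C \<in> elts E U" "\<forall>A\<in>H. elts E C \<subseteq> elts E A"
      using ultrafilter_obj_finite_inter[OF U] by blast
    then have "solutions C \<subseteq> (\<Inter>J\<in>G. elts E J)" using H(3) mono I(2) by blast
    then show ?thesis using nonempty[OF C(1)] by blast
  qed
  \<comment> \<open>The family is an image of \<open>U\<close>, so its cardinality is at most that
    of the power set and strictly below the successor cardinal.\<close>
  have small: "|I ` elts E U| <o cardSuc |Pow (elts E Y)|"
    using ordLeq_transitive[OF card_of_image card_ultrafilter_obj[OF U]]
      cardSuc_greater[OF card_of_Card_order] by (rule ordLeq_ordLess_trans)
  have "(\<Inter>J\<in>I ` elts E U. elts E J) \<noteq> {}"
  proof (rule sat[unfolded saturated_def, THEN spec, THEN mp], intro conjI ballI allI impI)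
    show "internal_set X E star J" if "J \<in> I ` elts E U" for J
      using that I(1) by blast
  qed (use small fip in blast)+
  then obtain a where a: "\<And>A. A \<in> elts E U \<Longrightarrow> a \<in> solutions A" using I(2) by auto
  then have a_monad: "a \<in> monad E star U" by (auto simp: monad_def solutions_def)
  \<comment> \<open>Membership in \<open>star A\<close> for a single \<open>A\<close> in
    \<open>U\<close> makes \<open>a\<close> internal, as the induction hypothesis requires.\<close>
  moreover obtain A where "A \<in> elts E U" using ultrafilter_obj_nonempty[OF U] by blast
  ultimately have "internal E star a"
    by (auto simp: monad_def internal_def elts_def)
  then have "internal E star ((e(i := a)) j)" for j
    using Suc.prems(1) by simp
  moreover have "sat X E (e(i := a)) (star_fm star
      (quantified (Suc i) (replicate n (Exists, Const A)) \<psi>))" if "A \<in> elts E U" for A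
    using a[OF that] by (simp only: solutions_def \<psi>'_def mem_Collect_eq)
  ultimately have "\<exists>\<alpha>. length \<alpha> = n \<and> set \<alpha> \<subseteq> monad E star U \<and>
      sat X E (assign (e(i := a)) (Suc i) \<alpha>) (star_fm star \<psi>)"
    by (rule Suc.IH)
  then obtain \<alpha> where "length \<alpha> = n" "set \<alpha> \<subseteq> monad E star U"
    "sat X E (assign (e(i := a)) (Suc i) \<alpha>) (star_fm star \<psi>)" by blast
  then show ?case using a_monad by (intro exI[of _ "a # \<alpha>"]) simp
qed

end

section \<open>Arbitrary quantifier prefixes as formulas with internal parameters\<close>

theorem theorem5p19:
  fixes X :: "'a set" and E :: "'a \<Rightarrow> 'a \<Rightarrow> bool" and star :: "'a \<Rightarrow> 'a"
    and Y U :: 'a and p S :: "'a list" and Q :: "quantifier list"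
    and \<phi> :: "'a fm" and n m k :: nat
  assumes "nonstandard_model X E star"
    and "saturated X E star (cardSuc |Pow (elts E Y)| )"
    and "ultrafilter_obj E Y U"
    and "length p = k" and "\<forall>x\<in>set p. internal E star x"
    and "length S = m" and "\<forall>s\<in>set S. internal_set X E star s"
    and "length Q = m"
    and "totally_open \<phi>" and "fvars \<phi> \<subseteq> {..<n + m + k}"
  shows "(\<forall>A\<in>elts E U. \<exists>\<alpha>. length \<alpha> = n \<and> set \<alpha> \<subseteq> elts E (star A) \<and>
             quantify E (zip Q S) (\<lambda>\<beta>. sat_list X E (\<alpha> @ \<beta> @ p) (star_fm star \<phi>)))
     \<longleftrightarrow> (\<exists>\<alpha>. length \<alpha> = n \<and> set \<alpha> \<subseteq> monad E star U \<and>
             quantify E (zip Q S) (\<lambda>\<beta>. sat_list X E (\<alpha> @ \<beta> @ p) (star_fm star \<phi>)))"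
proof -
  interpret nonstandard_model X E star by fact
  \<comment> \<open>The sets \<open>S\<^sub>j\<close> are the values of the additional variables from \<open>n + m + k\<close> on.\<close>
  define e where "e = assign (\<lambda>_. star undefined) (n + m) (p @ S)"
  \<comment> \<open>Layout of the variables: \<alpha> from 0, \<beta> from \<open>n\<close>,
    \<open>p\<close> from \<open>n + m\<close>, \<open>S\<close> from \<open>n + m + k\<close>. The
    bounds thus lie above the block of \<beta>.\<close>
  define qs :: "(quantifier \<times> 'a trm) list" where
    "qs = zip Q (map (\<lambda>j. Var (n + m + k + j)) [0..<m])"
  define \<psi> where "\<psi> = quantified n qs \<phi>"
  \<comment> \<open>The default \<open>star undefined\<close> keeps the variables outside the listed
    range internal too.\<close>
  have e_internal: "internal E star (e j)" for j
  proof -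
    have "internal E star x" if "x \<in> set (p @ S)" for x
      using that assms(5,7) by (auto simp: internal_set_def)
    then show ?thesis
      unfolding e_def assign_apply using internal_star nth_mem[of "j - (n + m)" "p @ S"] by auto
  qed
  have \<psi>_iff: "sat X E (assign e 0 \<alpha>) (star_fm star \<psi>) \<longleftrightarrow>
      quantify E (zip Q S) (\<lambda>\<beta>. sat_list X E (\<alpha> @ \<beta> @ p) (star_fm star \<phi>))"
    if \<alpha>: "length \<alpha> = n" for \<alpha>
  proof -
    \<comment> \<open>The star map leaves variables alone, and \<alpha> overwrites only indices
      below \<open>n\<close>.\<close>
    have bounds: "map (map_prod id (tval X E (assign e 0 \<alpha>)))
        (map (map_prod id (map_trm star)) qs) = zip Q S"
      using assms(4,6,8) \<alpha>
      by (auto intro!: nth_equalityI simp: qs_def e_def assign_apply nth_append)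
    have "sat X E (assign e 0 \<alpha>) (star_fm star \<psi>) \<longleftrightarrow>
        quantify E (zip Q S) (\<lambda>\<beta>. sat X E (assign (assign e 0 \<alpha>) n \<beta>) (star_fm star \<phi>))"
    proof -
      have "i < n \<or> n + length (map (map_prod id (map_trm star)) qs) \<le> i"
        if "(q, t) \<in> set (map (map_prod id (map_trm star)) qs)" "i \<in> tvars t" for q t i
        using that assms(8) by (auto simp: qs_def dest!: set_zip_rightD)
      then show ?thesis
        unfolding \<psi>_def map_fm_quantified by (subst sat_quantified) (simp_all only: bounds)
    qed
    also have "\<dots> \<longleftrightarrow> quantify E (zip Q S)
        (\<lambda>\<beta>. sat_list X E (\<alpha> @ \<beta> @ p) (star_fm star \<phi>))"
    \<comment> \<open>Agreement is needed only below \<open>n + m + k\<close>, where all free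
      variables of \<phi> lie; the entries of \<open>S\<close> come after.\<close>
    proof (rule quantify_cong)
      fix \<beta> :: "'a list" assume "length \<beta> = length (zip Q S)"
      then show "sat X E (assign (assign e 0 \<alpha>) n \<beta>) (star_fm star \<phi>) \<longleftrightarrow>
          sat_list X E (\<alpha> @ \<beta> @ p) (star_fm star \<phi>)"
        unfolding sat_list_def using assms(4,6,8,10) \<alpha>
        by (intro sat_cong) (auto simp: e_def assign_apply nth_append)
    qed
    finally show ?thesis .
  qed
  have exists_iff: "sat X E e (star_fm star (quantified 0 (replicate n (Exists, Const A)) \<psi>)) \<longleftrightarrow>
      (\<exists>\<alpha>. length \<alpha> = n \<and> set \<alpha> \<subseteq> elts E (star A) \<and>
        sat X E (assign e 0 \<alpha>) (star_fm star \<psi>))" for A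
    unfolding map_fm_quantified by (subst sat_quantified) (auto simp: quantify_replicate_Exists)
  have "\<exists>\<alpha>. length \<alpha> = n \<and> set \<alpha> \<subseteq> monad E star U \<and>
      sat X E (assign e 0 \<alpha>) (star_fm star \<psi>)"
    if "\<forall>A\<in>elts E U. \<exists>\<alpha>. length \<alpha> = n \<and> set \<alpha> \<subseteq> elts E (star A) \<and>
      sat X E (assign e 0 \<alpha>) (star_fm star \<psi>)"
    using that by (intro solution_in_monad[OF assms(2,3) e_internal]) (simp add: exists_iff)
  \<comment> \<open>For the converse, one solution in the monad serves every \<open>A\<close> at
    once.\<close>
  moreover have "monad E star U \<subseteq> elts E (star A)" if "A \<in> elts E U" for A
    using that by (auto simp: monad_def)
  ultimately show ?thesis using \<psi>_iff by (smt (verit) subset_trans)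
qed

end
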